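(* Let $\Gamma$ be an environment, $A$ a simple type and $M$ a good metaterm of $\lambda^{\to}_{\mathfrak m}$ such that $\mathrm{ver}_A(M^{\Gamma}) \twoheadrightarrow \star$. Then the $\beta$-normal form $M^{\downarrow}$ of $M$ is a term of the simply typed $\lambda$-calculus such that $\Gamma \vdash M^{\downarrow} : A$.
   Context: Simple types: $A,B ::= \mathbf{a} \mid A \Rightarrow B$, where $\mathbf{a}$ ranges over a denumerable set of atomic types. Terms: $t ::= x \mid \lambda x.t \mid t\,s$. An environment $\Gamma$ is a finite set $\{x_1:A_1,\dots,x_n:A_n\}$ of assignments to distinct variables. Typing is given by the usual rules: $\Gamma, x:A \vdash x:A$; from $\Gamma,x:A \vdash t:B$ infer $\Gamma \vdash \lambda x.t : A \Rightarrow B$; from $\Gamma\vdash t:A\Rightarrow B$ and $\Gamma \vdash s:A$ infer $\Gamma\vdash t\,s:B$. The metacalculus $\lambda^{\to}_{\mathfrak m}$ has metaterms $M,N ::= x \mid \lambda x.M \mid M\,N \mid \star \mid (M \triangleright N) \mid \mathrm{gen}_{\mathbf{a}} \mid \mathrm{ver}_{\mathbf{a}}(M)$ for atomic types $\mathbf{a}$ ($\star$ is a constant, $(M\triangleright N)$ is the guard). For arbitrary types: $\mathrm{gen}_{A\Rightarrow B} := \lambda x.(\mathrm{ver}_A(x) \triangleright \mathrm{gen}_B)$ ($x$ fresh) and $\mathrm{ver}_{A \Rightarrow B}(M) := \mathrm{ver}_B(M\,\mathrm{gen}_A)$. Reduction $\to$ is the closure under arbitrary contexts of $(\lambda x.M)\,N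 \to M\{x:=N\}$, $(\star \triangleright M) \to M$, $\mathrm{ver}_{\mathbf{a}}(\mathrm{gen}_{\mathbf{a}}) \to \star$; $\twoheadrightarrow$ is its reflexive-transitive closure. A metaterm is pure if it is built only from variables, abstractions and applications (pure metaterms are identified with terms); it is good if it is pure and $\beta$-normalizing (has a $\beta$-normal form). $M^{\Gamma}$ denotes $M$ with each free occurrence of each variable $x$ with $x:A\in\Gamma$ replaced by $\mathrm{gen}_A$ (other variables unchanged). *)

theory Defs
  imports Main
begin

datatype ty =
    Atom nat
  | Arr ty ty  (infixr \<open>\<rightarrow>\<close> 200)

text \<open>
  Metaterms up to alpha-equivalence, in de Bruijn notation: below \<open>n\<close> abstractions,
  the index \<open>n + x\<close> stands for the free variable \<open>x\<close>.
  \<open>Guard M N\<close> is \<open>(M \<triangleright> N)\<close>. Terms are identified with the pure metaterms.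
\<close>

datatype mterm =
    Var nat
  | Lam mterm
  | App mterm mterm
  | Star
  | Guard mterm mterm
  | Gen nat
  | Ver nat mterm

primrec pure :: "mterm \<Rightarrow> bool" where
  "pure (Var x) \<longleftrightarrow> True"
| "pure (Lam M) \<longleftrightarrow> pure M"
| "pure (App M N) \<longleftrightarrow> pure M \<and> pure N"
| "pure Star \<longleftrightarrow> False"
| "pure (Guard M N) \<longleftrightarrow> False"
| "pure (Gen a) \<longleftrightarrow> False"
| "pure (Ver a M) \<longleftrightarrow> False"

primrec rename :: "(nat \<Rightarrow> nat) \<Rightarrow> mterm \<Rightarrow> mterm" where
  "rename r (Var x) = Var (r x)"
| "rename r (Lam M) = Lam (rename (case_nat 0 (\<lambda>x. Suc (r x))) M)"
| "rename r (App M N) = App (rename r M) (rename r N)"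
| "rename r Star = Star"
| "rename r (Guard M N) = Guard (rename r M) (rename r N)"
| "rename r (Gen a) = Gen a"
| "rename r (Ver a M) = Ver a (rename r M)"

text \<open>Simultaneous capture-avoiding substitution of \<open>s x\<close> for every free variable \<open>x\<close>.\<close>

primrec subst :: "(nat \<Rightarrow> mterm) \<Rightarrow> mterm \<Rightarrow> mterm" where
  "subst s (Var x) = s x"
| "subst s (Lam M) = Lam (subst (case_nat (Var 0) (\<lambda>x. rename Suc (s x))) M)"
| "subst s (App M N) = App (subst s M) (subst s N)"
| "subst s Star = Star"
| "subst s (Guard M N) = Guard (subst s M) (subst s N)"
| "subst s (Gen a) = Gen a"
| "subst s (Ver a M) = Ver a (subst s M)"

text \<open>
  In \<open>gen (A \<rightarrow> B)\<close> no index of \<open>gen B\<close> has to be shifted, since \<open>gen B\<close> is closed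
  (see \<open>rename_gen\<close> below).
\<close>

function (sequential) gen :: "ty \<Rightarrow> mterm" and ver :: "ty \<Rightarrow> mterm \<Rightarrow> mterm" where
  "gen (Atom a) = Gen a"
| "gen (A \<rightarrow> B) = Lam (Guard (ver A (Var 0)) (gen B))"
| "ver (Atom a) M = Ver a M"
| "ver (A \<rightarrow> B) M = ver B (App M (gen A))"
  by pat_completeness auto
termination
  by (relation "measure (case_sum size (\<lambda>p. size (fst p)))") auto

lemma rename_gen: "rename r (gen A) = gen A"
  and rename_ver: "rename r (ver A M) = ver A (rename r M)"
  by (induction A and A M arbitrary: r and r rule: gen_ver.induct) simp_all

inductive beta_rule :: "mterm \<Rightarrow> mterm \<Rightarrow> bool" where
  "beta_rule (App (Lam M) N) (subst (case_nat N Var) M)"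

inductive meta_rule :: "mterm \<Rightarrow> mterm \<Rightarrow> bool" where
  beta: "beta_rule M N \<Longrightarrow> meta_rule M N"
| guard: "meta_rule (Guard Star M) M"
| ver: "meta_rule (Ver a (Gen a)) Star"

inductive ctxt_closure :: "(mterm \<Rightarrow> mterm \<Rightarrow> bool) \<Rightarrow> mterm \<Rightarrow> mterm \<Rightarrow> bool" for R where
  root: "R M N \<Longrightarrow> ctxt_closure R M N"
| Lam: "ctxt_closure R M N \<Longrightarrow> ctxt_closure R (Lam M) (Lam N)"
| App_left: "ctxt_closure R M N \<Longrightarrow> ctxt_closure R (App M P) (App N P)"
| App_right: "ctxt_closure R M N \<Longrightarrow> ctxt_closure R (App P M) (App P N)"
| Guard_left: "ctxt_closure R M N \<Longrightarrow> ctxt_closure R (Guard M P) (Guard N P)"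
| Guard_right: "ctxt_closure R M N \<Longrightarrow> ctxt_closure R (Guard P M) (Guard P N)"
| Ver: "ctxt_closure R M N \<Longrightarrow> ctxt_closure R (Ver a M) (Ver a N)"

abbreviation beta_red :: "mterm \<Rightarrow> mterm \<Rightarrow> bool" where
  "beta_red \<equiv> ctxt_closure beta_rule"

abbreviation meta_red :: "mterm \<Rightarrow> mterm \<Rightarrow> bool"  (infix \<open>\<longmapsto>\<close> 50) where
  "M \<longmapsto> N \<equiv> ctxt_closure meta_rule M N"

abbreviation meta_reds :: "mterm \<Rightarrow> mterm \<Rightarrow> bool"  (infix \<open>\<longmapsto>\<^sup>*\<close> 50) where
  "M \<longmapsto>\<^sup>* N \<equiv> (ctxt_closure meta_rule)\<^sup>*\<^sup>* M N"

definition is_beta_nf_of :: "mterm \<Rightarrow> mterm \<Rightarrow> bool" where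
  "is_beta_nf_of N M \<longleftrightarrow> beta_red\<^sup>*\<^sup>* M N \<and> \<not> (\<exists>N'. beta_red N N')"

definition good :: "mterm \<Rightarrow> bool" where
  "good M \<longleftrightarrow> pure M \<and> (\<exists>N. is_beta_nf_of N M)"

definition beta_nf :: "mterm \<Rightarrow> mterm" where
  "beta_nf M = (THE N. is_beta_nf_of N M)"

text \<open>
  Environments are the partial maps with finite domain; finiteness is assumed where
  environments are quantified. \<open>case_nat (Some A) \<Gamma>\<close> extends \<open>\<Gamma>\<close> by the assignment of \<open>A\<close>
  to the variable bound by the innermost abstraction.
\<close>

type_synonym env = "nat \<rightharpoonup> ty"

inductive typing :: "env \<Rightarrow> mterm \<Rightarrow> ty \<Rightarrow> bool"  (\<open>_ \<turnstile> _ : _\<close> [50, 50, 50] 50) where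
  Var: "\<Gamma> x = Some A \<Longrightarrow> \<Gamma> \<turnstile> Var x : A"
| Lam: "case_nat (Some A) \<Gamma> \<turnstile> t : B \<Longrightarrow> \<Gamma> \<turnstile> Lam t : A \<rightarrow> B"
| App: "\<Gamma> \<turnstile> t : A \<rightarrow> B \<Longrightarrow> \<Gamma> \<turnstile> s : A \<Longrightarrow> \<Gamma> \<turnstile> App t s : B"

text \<open>\<open>inst_env \<Gamma> M\<close> is \<open>M\<close> with superscript \<open>\<Gamma>\<close>.\<close>

definition inst_env :: "env \<Rightarrow> mterm \<Rightarrow> mterm" where
  "inst_env \<Gamma> = subst (\<lambda>x. case \<Gamma> x of None \<Rightarrow> Var x | Some A \<Rightarrow> gen A)"

end

(*
  The calculus is orthogonal, hence confluent, so a reduction to a normal form such as Star or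
  Gen a factors through every reduct. Thus M may be replaced by its beta-normal form, and one
  argues by induction on the size of this form. An abstraction is verified at B \<rightarrow> C by verifying
  its body at C with the bound variable replaced by gen B. For x N_1 ... N_k verified at
  A_1 \<rightarrow> ... \<rightarrow> A_n \<rightarrow> a, the metaterm gen B N_1 ... N_k gen A_1 ... gen A_n must reduce to Gen a.
  Every guard released by gen B has to be opened, so B has exactly k + n arguments and target a,
  each N_i is verified at the i-th argument type, and each gen A_i at the (k + i)-th.
  The latter forces these types to coincide, since gen of one type is verified only at that type.
*)
theory Submission
  imports Defs
begin

section \<open>Substitution\<close>

lemma rename_rename: "rename r (rename q M) = rename (\<lambda>x. r (q x)) M"
proof (induction M arbitrary: r q)
  case (Lam M)
  have "(\<lambda>x. case_nat 0 (\<lambda>x. Suc (r x)) (case_nat 0 (\<lambda>x. Suc (q x)) x))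
      = case_nat 0 (\<lambda>x. Suc (r (q x)))"
    by (auto split: nat.split)
  then show ?case by (simp add: Lam)
qed simp_all

lemma subst_rename: "subst s (rename r M) = subst (\<lambda>x. s (r x)) M"
proof (induction M arbitrary: r s)
  case (Lam M)
  have "(\<lambda>x. case_nat (Var 0) (\<lambda>x. rename Suc (s x)) (case_nat 0 (\<lambda>x. Suc (r x)) x))
      = case_nat (Var 0) (\<lambda>x. rename Suc (s (r x)))"
    by (auto split: nat.split)
  then show ?case by (simp add: Lam)
qed simp_all

lemma rename_subst: "rename r (subst s M) = subst (\<lambda>x. rename r (s x)) M"
proof (induction M arbitrary: r s)
  case (Lam M)
  have "(\<lambda>x. rename (case_nat 0 (\<lambda>x. Suc (r x))) (case_nat (Var 0) (\<lambda>x. rename Suc (s x)) x))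
      = case_nat (Var 0) (\<lambda>x. rename Suc (rename r (s x)))"
    by (auto split: nat.split simp: rename_rename)
  then show ?case by (simp add: Lam)
qed simp_all

lemma subst_subst: "subst t (subst s M) = subst (\<lambda>x. subst t (s x)) M"
proof (induction M arbitrary: t s)
  case (Lam M)
  have "(\<lambda>x. subst (case_nat (Var 0) (\<lambda>x. rename Suc (t x)))
            (case_nat (Var 0) (\<lambda>x. rename Suc (s x)) x))
      = case_nat (Var 0) (\<lambda>x. rename Suc (subst t (s x)))"
    by (auto split: nat.split simp: subst_rename rename_subst)
  then show ?case by (simp add: Lam)
qed simp_all

lemma subst_Var [simp]: "subst Var M = M"
proof (induction M)
  case (Lam M)
  have "case_nat (Var 0) (\<lambda>x. rename Suc (Var x)) = Var"
    by (auto split: nat.split)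
  then show ?case using Lam by simp
qed simp_all

lemma rename_subst_case_nat:
  "rename r (subst (case_nat N Var) M)
    = subst (case_nat (rename r N) Var) (rename (case_nat 0 (\<lambda>x. Suc (r x))) M)"
  by (auto simp: rename_subst subst_rename split: nat.split intro!: arg_cong[where f = "\<lambda>s. subst s M"])

text \<open>The shift made when \<open>s\<close> goes under the binder is undone by instantiating
  index 0. Used with \<open>N = gen B\<close>, this opens a verified abstraction.\<close>

lemma subst_case_nat_subst:
  "subst (case_nat N Var) (subst (case_nat (Var 0) (\<lambda>x. rename Suc (s x))) M)
    = subst (case_nat N s) M"
  by (auto simp: subst_subst subst_rename split: nat.split intro!: arg_cong[where f = "\<lambda>s. subst s M"])

lemma subst_subst_case_nat:
  "subst s (subst (case_nat N Var) M) = subst (case_nat (subst s N) s) M"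
  by (auto simp: subst_subst split: nat.split intro!: arg_cong[where f = "\<lambda>s. subst s M"])

text \<open>Generators are closed, so a substitution acts on \<open>ver A M\<close> only through
  \<open>M\<close>.\<close>

lemma subst_gen [simp]: "subst s (gen A) = gen A"
  and subst_ver [simp]: "subst s (ver A M) = ver A (subst s M)"
  by (induction A and A M arbitrary: s and s rule: gen_ver.induct) simp_all

lemma pure_rename [simp]: "pure (rename r M) = pure M"
  by (induction M arbitrary: r) simp_all

lemma pure_subst: "pure M \<Longrightarrow> (\<And>x. pure (s x)) \<Longrightarrow> pure (subst s M)"
  by (induction M arbitrary: s) (auto split: nat.split)

section \<open>Confluence\<close>

text \<open>Parallel reduction in the style of Tait and Martin-Loef: any set of redexes already
  present, of all three kinds, is contracted at once.\<close>

inductive par :: "mterm \<Rightarrow> mterm \<Rightarrow> bool" where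
  Var: "par (Var x) (Var x)"
| Lam: "par M M' \<Longrightarrow> par (Lam M) (Lam M')"
| App: "par M M' \<Longrightarrow> par N N' \<Longrightarrow> par (App M N) (App M' N')"
| Star: "par Star Star"
| Guard: "par M M' \<Longrightarrow> par N N' \<Longrightarrow> par (Guard M N) (Guard M' N')"
| Gen: "par (Gen a) (Gen a)"
| Ver: "par M M' \<Longrightarrow> par (Ver a M) (Ver a M')"
| beta: "par M M' \<Longrightarrow> par N N' \<Longrightarrow> par (App (Lam M) N) (subst (case_nat N' Var) M')"
| guard: "par M M' \<Longrightarrow> par (Guard Star M) M'"
| ver: "par (Ver a (Gen a)) Star"

inductive_cases par_LamE: "par (Lam M) N"
inductive_cases par_StarE: "par Star N"
inductive_cases par_GenE: "par (Gen a) N"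

lemma par_refl [simp]: "par M M"
  by (induction M) (auto intro: par.intros)

lemma par_rename: "par M N \<Longrightarrow> par (rename r M) (rename r N)"
proof (induction arbitrary: r rule: par.induct)
  case (beta M M' N N')
  then show ?case by (simp add: rename_subst_case_nat par.beta)
qed (auto intro: par.intros)

lemma par_subst:
  "par M N \<Longrightarrow> (\<And>x. par (s x) (t x)) \<Longrightarrow> par (subst s M) (subst t N)"
proof (induction arbitrary: s t rule: par.induct)
  case (Lam M M')
  then show ?case by (auto intro!: par.Lam Lam.IH par_rename split: nat.split)
next
  case (beta M M' N N')
  have "par (App (Lam (subst (case_nat (Var 0) (\<lambda>x. rename Suc (s x))) M)) (subst s N))
     (subst (case_nat (subst t N') Var) (subst (case_nat (Var 0) (\<lambda>x. rename Suc (t x))) M'))"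
    using beta.prems by (intro par.beta beta.IH) (auto intro!: par_rename split: nat.split)
  then show ?case by (simp add: subst_case_nat_subst subst_subst_case_nat)
qed (auto intro: par.intros)

lemma par_ver: "par M N \<Longrightarrow> par (ver A M) (ver A N)"
  by (induction A arbitrary: M N) (simp_all add: par.Ver par.App)

text \<open>Takahashi's complete development, contracting every redex present. The equations are
  tried in order, so the redex patterns precede the congruence cases.\<close>

fun develop :: "mterm \<Rightarrow> mterm" where
  "develop (App (Lam M) N) = subst (case_nat (develop N) Var) (develop M)"
| "develop (App M N) = App (develop M) (develop N)"
| "develop (Guard Star N) = develop N"
| "develop (Guard M N) = Guard (develop M) (develop N)"
| "develop (Ver a (Gen b)) = (if a = b then Star else Ver a (Gen b))"
| "develop (Ver a M) = Ver a (develop M)"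
| "develop (Lam M) = Lam (develop M)"
| "develop (Var x) = Var x"
| "develop Star = Star"
| "develop (Gen a) = Gen a"

text \<open>Triangle property: the rules do not overlap, so redexes left uncontracted in the step
  survive and can be contracted afterwards. The target depends on \<open>M\<close> alone, which
  gives the diamond property.\<close>

lemma par_develop: "par M N \<Longrightarrow> par N (develop M)"
proof (induction rule: par.induct)
  case (App M M' N N')
  show ?case
  proof (cases M)
    case (Lam P)
    \<comment> \<open>A reduct of an abstraction is an abstraction, so the beta redex is still
      there.\<close>
    with App.hyps obtain P' where "M' = Lam P'" by (auto elim: par_LamE)
    with App.IH Lam show ?thesis by (auto elim!: par_LamE intro: par.beta)
  qed (use App.IH in \<open>auto intro: par.intros\<close>)
next
  case (Guard M M' N N')
  then show ?case by (cases M) (auto elim: par_StarE intro: par.intros)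
next
  case (Ver M M' a)
  then show ?case by (cases M) (auto elim: par_GenE intro: par.intros)
next
  case (beta M M' N N')
  then show ?case by (auto intro!: par_subst split: nat.split)
qed (auto intro: par.intros)

lemma meta_red_imp_par: "M \<longmapsto> N \<Longrightarrow> par M N"
  by (induction rule: ctxt_closure.induct)
    (auto intro: par.intros elim!: meta_rule.cases beta_rule.cases)

section \<open>Agreement of parallel and one-step reduction sequences\<close>

lemma meta_reds_cong:
  assumes "M \<longmapsto>\<^sup>* N" and "\<And>M N. M \<longmapsto> N \<Longrightarrow> f M \<longmapsto> f N"
  shows "f M \<longmapsto>\<^sup>* f N"
  using assms(1) by induction (auto intro: rtranclp.rtrancl_into_rtrancl assms(2))

lemma meta_reds_App: "M \<longmapsto>\<^sup>* M' \<Longrightarrow> N \<longmapsto>\<^sup>* N' \<Longrightarrow> App M N \<longmapsto>\<^sup>* App M' N'"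
  using meta_reds_cong[of M M' "\<lambda>M. App M N"] meta_reds_cong[of N N' "App M'"]
  by (meson ctxt_closure.App_left ctxt_closure.App_right rtranclp_trans)

lemma meta_reds_Guard: "M \<longmapsto>\<^sup>* M' \<Longrightarrow> N \<longmapsto>\<^sup>* N' \<Longrightarrow> Guard M N \<longmapsto>\<^sup>* Guard M' N'"
  using meta_reds_cong[of M M' "\<lambda>M. Guard M N"] meta_reds_cong[of N N' "Guard M'"]
  by (meson ctxt_closure.Guard_left ctxt_closure.Guard_right rtranclp_trans)

lemma meta_reds_Lam: "M \<longmapsto>\<^sup>* M' \<Longrightarrow> Lam M \<longmapsto>\<^sup>* Lam M'"
  by (erule meta_reds_cong) (rule ctxt_closure.Lam)

lemma meta_reds_Ver: "M \<longmapsto>\<^sup>* M' \<Longrightarrow> Ver a M \<longmapsto>\<^sup>* Ver a M'"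
  by (erule meta_reds_cong) (rule ctxt_closure.Ver)

lemma meta_red_beta: "App (Lam M) N \<longmapsto> subst (case_nat N Var) M"
  by (intro ctxt_closure.root meta_rule.beta beta_rule.intros)

lemma par_imp_meta_reds: "par M N \<Longrightarrow> M \<longmapsto>\<^sup>* N"
proof (induction rule: par.induct)
  case (beta M M' N N')
  then have "App (Lam M) N \<longmapsto>\<^sup>* App (Lam M') N'" by (intro meta_reds_App meta_reds_Lam)
  then show ?case using meta_red_beta by (rule rtranclp.rtrancl_into_rtrancl)
next
  case (guard M M')
  have "Guard Star M \<longmapsto> M" by (intro ctxt_closure.root meta_rule.guard)
  then show ?case using guard.IH by (rule converse_rtranclp_into_rtranclp)
next
  case (ver a)
  show ?case by (intro r_into_rtranclp ctxt_closure.root meta_rule.ver)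
qed (auto intro: meta_reds_App meta_reds_Guard meta_reds_Lam meta_reds_Ver)

lemma meta_reds_eq_par: "meta_reds = par\<^sup>*\<^sup>*"
proof (rule antisym)
  show "meta_reds \<le> par\<^sup>*\<^sup>*" by (rule rtranclp_mono) (auto intro: meta_red_imp_par)
  have "par\<^sup>*\<^sup>* \<le> meta_reds\<^sup>*\<^sup>*" by (rule rtranclp_mono) (auto intro: par_imp_meta_reds)
  then show "par\<^sup>*\<^sup>* \<le> meta_reds" by simp
qed

lemma par_strip:
  assumes "par\<^sup>*\<^sup>* M N" and "par M P"
  shows "\<exists>Q. par N Q \<and> par\<^sup>*\<^sup>* P Q"
  using assms
proof (induction rule: rtranclp_induct)
  case base
  then show ?case by blast
next
  case (step N N')
  then obtain Q where "par N Q" "par\<^sup>*\<^sup>* P Q" by blast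
  \<comment> \<open>Both \<open>N'\<close> and \<open>Q\<close> are parallel reducts of
    \<open>N\<close>, hence meet in \<open>develop N\<close>.\<close>
  with step.hyps(2) show ?case
    by (meson par_develop rtranclp.rtrancl_into_rtrancl)
qed

lemma meta_reds_confluent:
  assumes "M \<longmapsto>\<^sup>* N" and "M \<longmapsto>\<^sup>* P"
  shows "\<exists>Q. N \<longmapsto>\<^sup>* Q \<and> P \<longmapsto>\<^sup>* Q"
  using assms(2,1) unfolding meta_reds_eq_par
proof (induction rule: rtranclp_induct)
  case base
  then show ?case by blast
next
  case (step P P')
  then obtain Q where "par\<^sup>*\<^sup>* N Q" "par\<^sup>*\<^sup>* P Q" by blast
  with par_strip[OF this(2) step.hyps(2)] show ?case
    by (meson rtranclp.rtrancl_into_rtrancl)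
qed

text \<open>The form in which confluence is used below: the common reduct of \<open>N\<close> and a
  normal \<open>P\<close> can only be \<open>P\<close>.\<close>

lemma meta_reds_to_normal:
  assumes "M \<longmapsto>\<^sup>* N" and "M \<longmapsto>\<^sup>* P" and "\<And>Q. \<not> P \<longmapsto> Q"
  shows "N \<longmapsto>\<^sup>* P"
  using meta_reds_confluent[OF assms(1,2)] assms(3) by (metis converse_rtranclpE)

section \<open>Normal forms, and stability under substitution and verification\<close>

lemma Gen_normal: "\<not> Gen a \<longmapsto> N"
  by (auto elim: ctxt_closure.cases meta_rule.cases beta_rule.cases)

lemma Star_normal: "\<not> Star \<longmapsto> N"
  by (auto elim: ctxt_closure.cases meta_rule.cases beta_rule.cases)

lemma Var_normal: "\<not> Var x \<longmapsto> N"
  by (auto elim: ctxt_closure.cases meta_rule.cases beta_rule.cases)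

inductive_cases meta_red_LamE: "Lam M \<longmapsto> N"

lemma Lam_not_meta_reds_Gen: "\<not> Lam M \<longmapsto>\<^sup>* Gen a"
proof
  have "\<exists>N'. N = Lam N'" if "Lam M \<longmapsto>\<^sup>* N" for N
    using that
    by induction (auto elim!: meta_red_LamE meta_rule.cases beta_rule.cases)
  moreover assume "Lam M \<longmapsto>\<^sup>* Gen a"
  ultimately show False by blast
qed

lemma meta_reds_subst: "M \<longmapsto>\<^sup>* N \<Longrightarrow> subst s M \<longmapsto>\<^sup>* subst s N"
  unfolding meta_reds_eq_par
  by (induction rule: rtranclp_induct) (auto elim!: rtranclp.rtrancl_into_rtrancl intro!: par_subst)

lemma meta_reds_ver: "M \<longmapsto>\<^sup>* N \<Longrightarrow> ver A M \<longmapsto>\<^sup>* ver A N"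
  unfolding meta_reds_eq_par
  by (induction rule: rtranclp_induct) (auto elim!: rtranclp.rtrancl_into_rtrancl intro!: par_ver)

section \<open>Beta-normal forms of pure metaterms\<close>

lemma beta_red_imp_meta_red: "beta_red M N \<Longrightarrow> M \<longmapsto> N"
  by (induction rule: ctxt_closure.induct) (auto intro: ctxt_closure.intros meta_rule.beta)

lemma beta_reds_imp_meta_reds: "beta_red\<^sup>*\<^sup>* M N \<Longrightarrow> M \<longmapsto>\<^sup>* N"
  by (metis beta_red_imp_meta_red mono_rtranclp)

text \<open>The redexes of the other two rules contain a guard or a verifier, which purity
  excludes.\<close>

lemma pure_meta_red_imp_beta_red: "M \<longmapsto> N \<Longrightarrow> pure M \<Longrightarrow> beta_red M N"
  by (induction rule: ctxt_closure.induct) (auto intro: ctxt_closure.intros elim: meta_rule.cases)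

lemma pure_beta_red: "beta_red M N \<Longrightarrow> pure M \<Longrightarrow> pure N"
  by (induction rule: ctxt_closure.induct)
    (auto elim!: beta_rule.cases intro!: pure_subst split: nat.split)

lemma pure_beta_reds: "beta_red\<^sup>*\<^sup>* M N \<Longrightarrow> pure M \<Longrightarrow> pure N"
  by (induction rule: rtranclp_induct) (auto intro: pure_beta_red)

text \<open>On pure metaterms beta-normal means normal for the full reduction, so confluence of the
  metacalculus suffices. This justifies the description operator in \<open>beta_nf\<close>.\<close>

lemma is_beta_nf_of_unique:
  assumes "pure M" and "is_beta_nf_of N M" and "is_beta_nf_of P M"
  shows "N = P"
proof -
  have normal: "\<not> Q \<longmapsto> Q'" if "is_beta_nf_of Q M" for Q Q'
    using that assms(1) pure_meta_red_imp_beta_red pure_beta_reds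
    unfolding is_beta_nf_of_def by blast
  have "N \<longmapsto>\<^sup>* P"
    using assms normal unfolding is_beta_nf_of_def
    by (meson assms(3) beta_reds_imp_meta_reds meta_reds_to_normal)
  then show ?thesis using normal[OF assms(2)] by (metis converse_rtranclpE)
qed

lemma good_is_beta_nf_of: "good M \<Longrightarrow> is_beta_nf_of (beta_nf M) M"
  unfolding good_def beta_nf_def by (metis is_beta_nf_of_unique theI)

section \<open>Spines\<close>

abbreviation apps :: "mterm \<Rightarrow> mterm list \<Rightarrow> mterm" where
  "apps \<equiv> foldl App"

abbreviation arrs :: "ty list \<Rightarrow> ty \<Rightarrow> ty" where
  "arrs \<equiv> foldr Arr"

lemma apps_eq_Lam_iff: "apps H Ps = Lam M \<longleftrightarrow> Ps = [] \<and> H = Lam M"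
  by (cases Ps rule: rev_cases) auto

lemma Gen_eq_apps_iff: "Gen a = apps H Ps \<longleftrightarrow> Ps = [] \<and> H = Gen a"
  by (cases Ps rule: rev_cases) auto

lemma subst_apps: "subst s (apps H Ps) = apps (subst s H) (map (subst s) Ps)"
  by (induction Ps arbitrary: H) auto

lemma pure_apps: "pure (apps H Ps) \<longleftrightarrow> pure H \<and> (\<forall>P\<in>set Ps. pure P)"
  by (induction Ps arbitrary: H) auto

lemma size_less_apps: "P \<in> set Ps \<Longrightarrow> size P < size (apps H Ps)"
  by (induction Ps rule: rev_induct) auto

lemma apps_meta_red: "H \<longmapsto> H' \<Longrightarrow> apps H Ps \<longmapsto> apps H' Ps"
  by (induction Ps rule: rev_induct) (auto intro: ctxt_closure.App_left)

lemma apps_meta_reds: "H \<longmapsto>\<^sup>* H' \<Longrightarrow> apps H Ps \<longmapsto>\<^sup>* apps H' Ps"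
  by (erule meta_reds_cong) (rule apps_meta_red)

lemma apps_beta_red_head: "beta_red H H' \<Longrightarrow> beta_red (apps H Ps) (apps H' Ps)"
  by (induction Ps rule: rev_induct) (auto intro: ctxt_closure.App_left)

lemma apps_beta_red_arg:
  "P \<in> set Ps \<Longrightarrow> beta_red P P' \<Longrightarrow> \<exists>N. beta_red (apps H Ps) N"
  by (induction Ps rule: rev_induct) (auto intro: ctxt_closure.intros)

text \<open>Head analysis: abstraction, variable head, or head redex. Beta-normality later excludes
  the third case.\<close>

lemma pure_cases:
  assumes "pure M"
  obtains N where "M = Lam N"
  | x Ps where "M = apps (Var x) Ps"
  | N P Ps where "M = apps (App (Lam N) P) Ps"
  using assms
proof (induction M arbitrary: thesis)
  case (Var x)
  from Var.prems(2)[of x "[]"] show ?case by simp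
next
  case (App M1 M2)
  show ?case
  proof (rule App.IH(1))
    fix N assume "M1 = Lam N"
    then show ?case using App.prems(3)[of N M2 "[]"] by simp
  next
    fix x Ps assume "M1 = apps (Var x) Ps"
    then show ?case using App.prems(2)[of x "Ps @ [M2]"] by simp
  next
    fix N P Ps assume "M1 = apps (App (Lam N) P) Ps"
    then show ?case using App.prems(3)[of N P "Ps @ [M2]"] by simp
  qed (use App.prems in simp)
qed simp_all

text \<open>Unless the head is an abstraction, no application node of the spine is a redex, so a
  step happens inside the head or inside one argument.\<close>

lemma meta_red_apps_cases:
  assumes "apps H Ps \<longmapsto> N" and "\<And>M. H \<noteq> Lam M"
  obtains H' Ps' where "N = apps H' Ps'" and "length Ps' = length Ps" and "H' = H \<or> H \<longmapsto> H'"
  using assms(1)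
proof (induction Ps arbitrary: N thesis rule: rev_induct)
  case Nil
  from Nil(2) Nil(1)[of N "[]"] show ?case by simp
next
  case (snoc P Ps)
  from snoc.prems(2) have "App (apps H Ps) P \<longmapsto> N" by simp
  then show ?case
  proof cases
    case root
    then show ?thesis
      using assms(2) by (auto elim!: meta_rule.cases beta_rule.cases simp: apps_eq_Lam_iff)
  next
    case (App_left M')
    then obtain H' Ps' where "M' = apps H' Ps'" "length Ps' = length Ps" "H' = H \<or> H \<longmapsto> H'"
      using snoc.IH by blast
    with App_left snoc.prems(1)[of H' "Ps' @ [P]"] show ?thesis by simp
  next
    case (App_right P')
    with snoc.prems(1)[of H "Ps @ [P']"] show ?thesis by simp
  qed
qed

lemma meta_reds_apps_rigid:
  assumes "apps H Ps \<longmapsto>\<^sup>* N" and "\<And>M. H \<noteq> Lam M" and "\<And>H'. \<not> H \<longmapsto> H'"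
  obtains Ps' where "N = apps H Ps'" and "length Ps' = length Ps"
  using assms(1)
proof (induction arbitrary: thesis rule: rtranclp_induct)
  case base
  then show ?case by blast
next
  case (step N N')
  then obtain Ps' where "N = apps H Ps'" "length Ps' = length Ps" by blast
  with step show ?case using assms(2,3) by (metis meta_red_apps_cases)
qed

text \<open>A guard in head position blocks the spine until it is opened. Since \<open>Gen a\<close>
  contains no guard, it must be opened, and only \<open>Star\<close> opens it.\<close>

lemma meta_reds_apps_Guard:
  assumes "apps (Guard P R) Ps \<longmapsto>\<^sup>* Gen a"
  shows "P \<longmapsto>\<^sup>* Star"
  using assms
proof (induction "apps (Guard P R) Ps" arbitrary: P R Ps rule: converse_rtranclp_induct)
  case base
  then show ?case by (simp add: Gen_eq_apps_iff)
next
  case (step N)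
  from step.hyps(1) obtain H' Ps' where N: "N = apps H' Ps'"
    and "H' = Guard P R \<or> Guard P R \<longmapsto> H'"
    by (rule meta_red_apps_cases) auto
  then consider "H' = Guard P R" | "Guard P R \<longmapsto> H'" by blast
  then show ?case
  proof cases
    case 1
    with N step.hyps(3) show ?thesis by blast
  next
    case 2
    then show ?thesis
    proof cases
      \<comment> \<open>The guard rule is the only one that fits here, so \<open>P\<close> already
        is \<open>Star\<close>.\<close>
      case root
      then show ?thesis by (auto elim!: meta_rule.cases beta_rule.cases)
    next
      case (Guard_left P')
      with N step.hyps(3) have "P' \<longmapsto>\<^sup>* Star" by blast
      with Guard_left show ?thesis by (simp add: converse_rtranclp_into_rtranclp)
    next
      case (Guard_right R')
      with N step.hyps(3) show ?thesis by blast
    qed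
  qed
qed

section \<open>Verification\<close>

lemma arrs_Atom_exists: "\<exists>As a. A = arrs As (Atom a)"
proof (induction A)
  case (Atom a)
  show ?case by (intro exI[of _ "[]"]) simp
next
  case (Arr A B)
  then obtain As a where "B = arrs As (Atom a)" by blast
  then have "A \<rightarrow> B = arrs (A # As) (Atom a)" by simp
  then show ?case by blast
qed

lemma size_less_arrs: "B \<in> set Bs \<Longrightarrow> size B < size (arrs Bs C)"
  by (induction Bs) auto

lemma ver_arrs: "ver (arrs As B) M = ver B (apps M (map gen As))"
  by (induction As arbitrary: M) auto

text \<open>The outer verifier disappears only by contracting \<open>Ver a (Gen a)\<close>; all
  earlier steps take place in \<open>M\<close>.\<close>

lemma meta_reds_Ver_Star: "Ver a M \<longmapsto>\<^sup>* Star \<Longrightarrow> M \<longmapsto>\<^sup>* Gen a"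
proof (induction "Ver a M" arbitrary: M rule: converse_rtranclp_induct)
  case (step N)
  from step.hyps(1) show ?case
  proof cases
    case root
    then show ?thesis by (auto elim!: meta_rule.cases beta_rule.cases)
  next
    case (Ver M')
    with step.hyps(3) have "M' \<longmapsto>\<^sup>* Gen a" by blast
    with Ver show ?thesis by (simp add: converse_rtranclp_into_rtranclp)
  qed
qed

lemma meta_reds_ver_arrs_Star:
  "ver (arrs As (Atom a)) M \<longmapsto>\<^sup>* Star \<Longrightarrow> apps M (map gen As) \<longmapsto>\<^sup>* Gen a"
  by (simp add: ver_arrs meta_reds_Ver_Star)

text \<open>Inversion for generators. Too few arguments leave an abstraction and too many leave an
  applied \<open>Gen\<close>, so the lengths agree; each argument consumed releases a guard that has
  to be opened.\<close>

lemma meta_reds_apps_gen: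
  assumes "apps (gen B) Ps \<longmapsto>\<^sup>* Gen a"
  obtains Bs where "B = arrs Bs (Atom a)" and "list_all2 (\<lambda>B P. ver B P \<longmapsto>\<^sup>* Star) Bs Ps"
  using assms
proof (induction B arbitrary: Ps thesis)
  case (Atom b)
  from Atom.prems(2) obtain Ps' where "Gen a = apps (Gen b) Ps'" "length Ps' = length Ps"
    by (auto elim: meta_reds_apps_rigid simp: Gen_normal)
  then have "Ps = []" "a = b" by (auto simp: Gen_eq_apps_iff)
  then show ?case using Atom.prems(1)[of "[]"] by simp
next
  case (Arr B C)
  show ?case
  proof (cases Ps)
    case Nil
    with Arr.prems(2) show ?thesis by (simp add: Lam_not_meta_reds_Gen)
  next
    case (Cons P Qs)
    \<comment> \<open>The argument enters only the guard, because \<open>gen C\<close> is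
      closed.\<close>
    have "App (gen (B \<rightarrow> C)) P \<longmapsto> Guard (ver B P) (gen C)"
      using meta_red_beta[of "Guard (ver B (Var 0)) (gen C)" P] by simp
    then have "apps (gen (B \<rightarrow> C)) Ps \<longmapsto>\<^sup>* apps (Guard (ver B P) (gen C)) Qs"
      using Cons by (auto intro: apps_meta_red)
    with Arr.prems(2) have *: "apps (Guard (ver B P) (gen C)) Qs \<longmapsto>\<^sup>* Gen a"
      by (meson Gen_normal meta_reds_to_normal)
    then have P: "ver B P \<longmapsto>\<^sup>* Star" by (rule meta_reds_apps_Guard)
    have "Guard Star (gen C) \<longmapsto> gen C" by (intro ctxt_closure.root meta_rule.guard)
    with P have "Guard (ver B P) (gen C) \<longmapsto>\<^sup>* gen C"
      by (meson meta_reds_Guard rtranclp.rtrancl_into_rtrancl rtranclp.rtrancl_refl)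
    \<comment> \<open>Opening the guard first is harmless: by confluence the result still reaches
      \<open>Gen a\<close>.\<close>
    then have "apps (gen C) Qs \<longmapsto>\<^sup>* Gen a"
      using * by (meson Gen_normal apps_meta_reds meta_reds_to_normal)
    then obtain Cs where "C = arrs Cs (Atom a)" "list_all2 (\<lambda>B P. ver B P \<longmapsto>\<^sup>* Star) Cs Qs"
      using Arr.IH(2) by blast
    then show ?thesis using Arr.prems(1)[of "B # Cs"] P Cons by simp
  qed
qed

text \<open>Verification exchanges roles: the generators of the arguments of \<open>A\<close> are
  verified at the arguments of \<open>B\<close>. The measure \<open>size A + size B\<close> is
  symmetric and decreases regardless of the exchange.\<close>

lemma ver_gen_Star_imp_eq: "ver A (gen B) \<longmapsto>\<^sup>* Star \<Longrightarrow> A = B"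
proof (induction "size A + size B" arbitrary: A B rule: less_induct)
  case less
  obtain As a where A: "A = arrs As (Atom a)" using arrs_Atom_exists by blast
  with less.prems have "apps (gen B) (map gen As) \<longmapsto>\<^sup>* Gen a"
    by (auto intro: meta_reds_ver_arrs_Star)
  then obtain Bs where B: "B = arrs Bs (Atom a)"
    and "list_all2 (\<lambda>B P. ver B P \<longmapsto>\<^sup>* Star) Bs (map gen As)"
    by (rule meta_reds_apps_gen)
  then have "list_all2 (\<lambda>B A. ver B (gen A) \<longmapsto>\<^sup>* Star) Bs As"
    by (simp add: list.rel_map)
  then have "list_all2 (=) Bs As"
  proof (rule list.rel_mono_strong)
    fix D C
    assume "D \<in> set Bs" "C \<in> set As" "ver D (gen C) \<longmapsto>\<^sup>* Star"
    then show "D = C"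
      using less.hyps[of D C] size_less_arrs[of D Bs] size_less_arrs[of C As] A B
      by (metis add.commute add_less_mono)
  qed
  with A B show ?case by (simp add: list.rel_eq)
qed

lemma typing_apps:
  "list_all2 (\<lambda>B N. \<Gamma> \<turnstile> N : B) Bs Ns \<Longrightarrow> \<Gamma> \<turnstile> M : arrs Bs C \<Longrightarrow> \<Gamma> \<turnstile> apps M Ns : C"
  by (induction arbitrary: M rule: list_all2_induct) (auto intro: typing.App)

text \<open>
  Opening an abstraction shifts the variables outside the environment, so the induction has to
  allow their renaming.
\<close>

lemma typing_if_verified:
  assumes "pure M" and "\<And>N. \<not> beta_red M N" and "ver A (subst s M) \<longmapsto>\<^sup>* Star"
    and "\<And>x. case \<Gamma> x of None \<Rightarrow> \<exists>y. s x = Var y | Some B \<Rightarrow> s x = gen B"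
  shows "\<Gamma> \<turnstile> M : A"
  using assms
proof (induction "size M" arbitrary: M \<Gamma> A s rule: less_induct)
  case less
  obtain As a where A: "A = arrs As (Atom a)" using arrs_Atom_exists by blast
  with less.prems(3) have red: "apps (subst s M) (map gen As) \<longmapsto>\<^sup>* Gen a"
    by (auto intro: meta_reds_ver_arrs_Star)
  from less.prems(1) show ?case
  proof (cases rule: pure_cases)
    case (1 N)
    show ?thesis
    proof (cases A)
      case (Atom b)
      \<comment> \<open>At an atomic type \<open>As\<close> is empty, and an abstraction would have
        to reduce to \<open>Gen a\<close>.\<close>
      with A red 1 show ?thesis by (cases As) (auto simp: Lam_not_meta_reds_Gen)
    next
      case (Arr B C)
      \<comment> \<open>The new substitution sends the bound variable to the generator of its type,
        as the extended environment requires.\<close>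
      have "App (subst s M) (gen B) \<longmapsto> subst (case_nat (gen B) s) N"
        using meta_red_beta[of "subst (case_nat (Var 0) (\<lambda>x. rename Suc (s x))) N" "gen B"] 1
        by (simp add: subst_case_nat_subst)
      then have "ver A (subst s M) \<longmapsto>\<^sup>* ver C (subst (case_nat (gen B) s) N)"
        using Arr by (auto intro!: meta_reds_ver)
      then have "ver C (subst (case_nat (gen B) s) N) \<longmapsto>\<^sup>* Star"
        using less.prems(3) Star_normal by (rule meta_reds_to_normal)
      then have "case_nat (Some B) \<Gamma> \<turnstile> N : C"
      proof (rule less.hyps[rotated 3])
        show "\<not> beta_red N N'" for N'
          using less.prems(2) 1 by (auto intro: ctxt_closure.Lam)
        show "case case_nat (Some B) \<Gamma> x of None \<Rightarrow> \<exists>y. case_nat (gen B) s x = Var y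
            | Some D \<Rightarrow> case_nat (gen B) s x = gen D" for x
          \<comment> \<open>Index 0 is the bound variable; any other index \<open>x\<close> is the
            old variable \<open>x - 1\<close>.\<close>
          using less.prems(4)[of "x - 1"] by (cases x) (auto split: option.splits)
      qed (use less.prems(1) 1 in simp_all)
      with 1 Arr show ?thesis by (simp add: typing.Lam)
    qed
  next
    case (2 x Ps)
    \<comment> \<open>The arguments proper come first, then the generators supplied by the
      verification at \<open>A\<close>.\<close>
    let ?Qs = "map (subst s) Ps @ map gen As"
    from red 2 have red: "apps (s x) ?Qs \<longmapsto>\<^sup>* Gen a" by (simp add: subst_apps)
    show ?thesis
    proof (cases "\<Gamma> x")
      case None
      with less.prems(4)[of x] obtain y where "s x = Var y" by auto
      \<comment> \<open>An undeclared variable would stay in head position forever, so the head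
        variable must be declared.\<close>
      with red have "apps (Var y) ?Qs \<longmapsto>\<^sup>* Gen a" by simp
      then obtain Qs' where "Gen a = apps (Var y) Qs'"
        by (rule meta_reds_apps_rigid) (auto simp: Var_normal)
      then show ?thesis by (simp add: Gen_eq_apps_iff)
    next
      case (Some B)
      with less.prems(4)[of x] red have "apps (gen B) ?Qs \<longmapsto>\<^sup>* Gen a" by simp
      then obtain Bs where B: "B = arrs Bs (Atom a)"
        and "list_all2 (\<lambda>B P. ver B P \<longmapsto>\<^sup>* Star) Bs ?Qs"
        by (rule meta_reds_apps_gen)
      \<comment> \<open>The argument types of \<open>B\<close> are split at the end of
        \<open>Ps\<close>.\<close>
      then obtain Cs Ds where Bs: "Bs = Cs @ Ds"
        and Cs: "list_all2 (\<lambda>C P. ver C (subst s P) \<longmapsto>\<^sup>* Star) Cs Ps"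
        and Ds: "list_all2 (\<lambda>D A. ver D (gen A) \<longmapsto>\<^sup>* Star) Ds As"
        by (auto simp: list_all2_append2 list.rel_map)
      from Ds have "list_all2 (=) Ds As"
        by (rule list.rel_mono_strong) (rule ver_gen_Star_imp_eq)
      then have "Ds = As" by (simp add: list.rel_eq)
      from Cs have "list_all2 (\<lambda>C P. \<Gamma> \<turnstile> P : C) Cs Ps"
      proof (rule list.rel_mono_strong)
        fix C P
        assume "P \<in> set Ps" and ver: "ver C (subst s P) \<longmapsto>\<^sup>* Star"
        have "\<not> beta_red P P'" for P'
          using \<open>P \<in> set Ps\<close> 2 less.prems(2) apps_beta_red_arg by blast
        then show "\<Gamma> \<turnstile> P : C"
          using \<open>P \<in> set Ps\<close> 2 less.prems(1) ver less.prems(4)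
          by (intro less.hyps) (auto simp: size_less_apps pure_apps)
      qed
      \<comment> \<open>With \<open>Ds = As\<close>, what remains of \<open>B\<close> after the
        types \<open>Cs\<close> is exactly \<open>A\<close>.\<close>
      moreover have "\<Gamma> \<turnstile> Var x : arrs Cs A"
        using Some A B Bs \<open>Ds = As\<close> by (simp add: typing.Var)
      ultimately show ?thesis using 2 by (simp add: typing_apps)
    qed
  next
    case (3 N P Ps)
    then show ?thesis
      using less.prems(2) by (metis apps_beta_red_head beta_rule.intros ctxt_closure.root)
  qed
qed

theorem theorem3p14:
  fixes \<Gamma> :: env and A :: ty and M :: mterm
  assumes "finite (dom \<Gamma>)"
    and "good M"
    and "ver A (inst_env \<Gamma> M) \<longmapsto>\<^sup>* Star"
  shows "pure (beta_nf M) \<and> \<Gamma> \<turnstile> beta_nf M : A"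
proof -
  have nf: "beta_red\<^sup>*\<^sup>* M (beta_nf M)" "\<And>N. \<not> beta_red (beta_nf M) N"
    using good_is_beta_nf_of[OF assms(2)] unfolding is_beta_nf_of_def by auto
  have pure: "pure (beta_nf M)"
    using nf(1) assms(2) pure_beta_reds unfolding good_def by blast
  \<comment> \<open>Normalizing \<open>M\<close> is a reduction below the instantiation and the
    verifier; confluence then transfers the reduction to \<open>Star\<close>.\<close>
  have "ver A (inst_env \<Gamma> M) \<longmapsto>\<^sup>* ver A (inst_env \<Gamma> (beta_nf M))"
    unfolding inst_env_def
    by (intro meta_reds_ver meta_reds_subst beta_reds_imp_meta_reds nf(1))
  then have "ver A (inst_env \<Gamma> (beta_nf M)) \<longmapsto>\<^sup>* Star"
    using assms(3) Star_normal by (rule meta_reds_to_normal)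
  then have "\<Gamma> \<turnstile> beta_nf M : A"
    unfolding inst_env_def by (rule typing_if_verified[OF pure nf(2)]) (simp split: option.split)
  with pure show ?thesis by simp
qed

end
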